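(* Let $m,n$ be two positive integers with $m<n$. Then for each integer $k$ such that $1<2k\leq m$ and $k\leq n-m$, we have $$P^k_{n}-P^k_{n-m}=m\sum_{r=1}^{k}\binom{k}{r}P^{r-1}_{m-r-1}P^{k-r}_{n-m+r}.$$
   Context: For natural numbers $k,n$ with $0\leq k\leq n$, $P^k_n=\frac{n!}{(n-k)!}$ (the number of $k$-permutations of $n$ objects, i.e. the falling factorial $n(n-1)\cdots(n-k+1)$) and $\binom{n}{k}=\frac{n!}{k!(n-k)!}$, with $0!=1$. *)

theory Defs
  imports Main
begin

text \<open>
  The number of k-permutations of n objects, n! / (n - k)!.  It is meaningful only for
  \<^prop>\<open>k \<le> n\<close>; in that range the natural-number division is exact
  (see \<open>kperm_mult_fact\<close>).
\<close>

definition kperm :: "nat \<Rightarrow> nat \<Rightarrow> nat"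
  where "kperm n k = fact n div fact (n - k)"

lemma kperm_mult_fact: "kperm n k * fact (n - k) = fact n"
  unfolding kperm_def by (rule dvd_div_mult_self) (simp add: fact_dvd)

end

theory Submission
  imports Defs
begin

text \<open>
  Let \<open>(x)\<^sub>k = x (x - 1) \<dots> (x - k + 1)\<close> and \<open>a = n - m\<close>.  The subtracted permutation number
  \<open>(a)\<^sub>k\<close> is the missing term \<open>r = 0\<close> of the sum once the factor \<open>m (m - r - 1)\<^bsub>r-1\<^esub>\<close>, which
  equals \<open>m / (m - r) \<cdot> (m - r)\<^sub>r\<close> for \<open>0 < r < m\<close>, is read as \<open>1\<close> at \<open>r = 0\<close>.  With \<open>w(x, r)\<close>
  denoting this factor for a general integer \<open>x\<close>, the theorem becomes a case of the Rothe--Hagen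
  convolution identity
  \<open>(\<Sum>r\<le>k. (k choose r) w(x, r) (a + r)\<^bsub>k-r\<^esub>) = (a + x)\<^sub>k\<close>,
  which is a polynomial identity and therefore can be proved for all integers \<open>x\<close> and \<open>a\<close>.

  The proof compares forward differences in \<open>x\<close>, by induction on \<open>k\<close>.  The weights satisfy
  \<open>w(x + 1, r) - w(x, r) = r w(x - 1, r - 1)\<close> for \<open>r > 0\<close> (lemma \<open>rothe_weight_diff\<close>),
  so for \<open>k > 0\<close> the difference
  of the left-hand side is \<open>k\<close> times the same sum for \<open>k - 1\<close>, \<open>x - 1\<close> and \<open>a + 1\<close>; by the
  induction hypothesis it is \<open>k (a + x)\<^bsub>k-1\<^esub>\<close>, the difference of the right-hand side
  (lemma \<open>ffact_diff\<close>).  At \<open>x = 0\<close> all weights but the first vanish and both sides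
  are \<open>(a)\<^sub>k\<close>.  The argument shifts \<open>x\<close> and \<open>a\<close> in opposite directions and leaves the range where
  the factors count permutations, hence the passage to integers (lemma \<open>rothe_convolution\<close>).
  The bounds \<open>2 k \<le> m\<close> and \<open>k \<le> n - m\<close> ensure that every permutation number in the theorem is
  a falling factorial (lemma \<open>kperm_eq_ffact\<close>).
\<close>

definition ffact :: "'a::comm_ring_1 \<Rightarrow> nat \<Rightarrow> 'a"
  where "ffact x k = (\<Prod>i<k. x - of_nat i)"

lemma ffact_0 [simp]: "ffact x 0 = 1"
  by (simp add: ffact_def)

lemma ffact_Suc: "ffact x (Suc k) = ffact x k * (x - of_nat k)"
  by (simp add: ffact_def)

lemma ffact_plus1_Suc: "ffact (x + 1) (Suc k) = (x + 1) * ffact x k"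
  unfolding ffact_def by (subst prod.lessThan_Suc_shift) simp

lemma ffact_diff: "ffact (x + 1) (Suc k) - ffact x (Suc k) = of_nat (Suc k) * ffact x k"
  unfolding ffact_plus1_Suc unfolding ffact_Suc by (simp add: algebra_simps)

lemma ffact_mult_fact:
  assumes "k \<le> n"
  shows "ffact (of_nat n) k * fact (n - k) = (fact n :: 'a::{comm_ring_1,semiring_char_0})"
  using assms
proof (induction k)
  case 0
  show ?case by simp
next
  case (Suc k)
  then have "n - k = Suc (n - Suc k)" by simp
  then have "fact (n - k) = (of_nat (n - k) * fact (n - Suc k) :: 'a)"
    by (metis fact_Suc)
  with Suc show ?case
    by (simp add: ffact_Suc of_nat_diff mult.assoc)
qed

lemma kperm_eq_ffact:
  assumes "k \<le> n"
  shows "int (kperm n k) = ffact (int n) k"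
proof -
  have "int (kperm n k) * fact (n - k) = int (kperm n k * fact (n - k))"
    by simp
  also have "\<dots> = ffact (int n) k * fact (n - k)"
    unfolding kperm_mult_fact using ffact_mult_fact[OF assms, where 'a = int] by simp
  finally show ?thesis by simp
qed

text \<open>
  The polynomial form of \<open>x / (x - r) \<cdot> (x - r)\<^sub>r\<close>, with the factor \<open>x - r\<close> cancelled when \<open>r > 0\<close>.
  At a natural number \<open>x \<ge> 3\<close> with \<open>2 r \<le> x\<close> it counts the ordered selections of \<open>r\<close> pairwise
  non-adjacent vertices of a cycle of length \<open>x\<close>.
\<close>

definition rothe_weight :: "'a::comm_ring_1 \<Rightarrow> nat \<Rightarrow> 'a"
  where "rothe_weight x r = (if r = 0 then 1 else x * ffact (x - of_nat r - 1) (r - 1))"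

lemma rothe_weight_0 [simp]: "rothe_weight x 0 = 1"
  by (simp add: rothe_weight_def)

lemma rothe_weight_Suc: "rothe_weight x (Suc s) = x * ffact (x - of_nat s - 2) s"
  by (simp add: rothe_weight_def algebra_simps)

text \<open>
  Both weights on the left contain the product \<open>ffact (x - r - 1) (r - 2)\<close> for \<open>r = s + 1 \<ge> 2\<close>;
  what remains is the identity \<open>(x + 1) (x - r) - x (x - 2 r + 1) = r (x - 1)\<close>.
\<close>

lemma rothe_weight_diff:
  "rothe_weight (x + 1) (Suc s) - rothe_weight x (Suc s) = of_nat (Suc s) * rothe_weight (x - 1) s"
proof (cases s)
  case 0
  then show ?thesis by (simp add: rothe_weight_Suc)
next
  case (Suc t)
  define y where "y = x - of_nat t - 3"
  have y: "x + 1 - of_nat s - 2 = y + 1" "x - of_nat s - 2 = y" "x - 1 - of_nat t - 2 = y"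
    by (simp_all add: y_def Suc algebra_simps)
  have "rothe_weight (x + 1) (Suc s) - rothe_weight x (Suc s)
      = ((x + 1) * (y + 1) - x * (y - of_nat t)) * ffact y t"
    unfolding rothe_weight_Suc y unfolding Suc ffact_plus1_Suc unfolding ffact_Suc
    by (simp add: algebra_simps)
  also have "(x + 1) * (y + 1) - x * (y - of_nat t) = of_nat (Suc s) * (x - 1)"
    by (simp add: y_def Suc algebra_simps)
  also have "\<dots> * ffact y t = of_nat (Suc s) * rothe_weight (x - 1) s"
    by (simp only: Suc rothe_weight_Suc y mult.assoc)
  finally show ?thesis .
qed

text \<open>
  The difference computation carries the identity from \<open>x\<close> to \<open>x + 1\<close> and back, so together with
  the case \<open>x = 0\<close> it reaches every integer.  This induction cannot stay within \<open>x \<ge> 0\<close>: at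
  \<open>x = 0\<close> the difference involves the identity for \<open>k - 1\<close> at \<open>x = -1\<close>.
\<close>

lemma rothe_convolution:
  fixes x a :: int
  shows "(\<Sum>r\<le>k. int (k choose r) * rothe_weight x r * ffact (a + int r) (k - r)) = ffact (a + x) k"
proof (induction k arbitrary: x a)
  case 0
  show ?case by simp
next
  case (Suc k)
  define S where
    "S x = (\<Sum>r\<le>Suc k. int (Suc k choose r) * rothe_weight x r * ffact (a + int r) (Suc k - r))" for x
  have diff: "S (x + 1) - S x = ffact (a + (x + 1)) (Suc k) - ffact (a + x) (Suc k)" for x
  proof -
    have "S (x + 1) - S x = (\<Sum>r\<le>Suc k. int (Suc k choose r) *
        (rothe_weight (x + 1) r - rothe_weight x r) * ffact (a + int r) (Suc k - r))"
      unfolding S_def sum_subtractf[symmetric] by (rule sum.cong) (simp_all add: algebra_simps)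
    also have "\<dots> = (\<Sum>s\<le>k. int (Suc k choose Suc s) *
        (int (Suc s) * rothe_weight (x - 1) s) * ffact (a + 1 + int s) (k - s))"
      unfolding sum.atMost_Suc_shift rothe_weight_diff by (simp add: algebra_simps)
    also have "\<dots> = (\<Sum>s\<le>k. int (Suc k) *
        (int (k choose s) * rothe_weight (x - 1) s * ffact (a + 1 + int s) (k - s)))"
    proof (rule sum.cong)
      fix s
      have "int (Suc k choose Suc s) * int (Suc s) = int (Suc k) * int (k choose s)"
        by (metis Suc_times_binomial mult.commute of_nat_mult)
      then show "int (Suc k choose Suc s) * (int (Suc s) * rothe_weight (x - 1) s) *
          ffact (a + 1 + int s) (k - s) = int (Suc k) *
          (int (k choose s) * rothe_weight (x - 1) s * ffact (a + 1 + int s) (k - s))"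
        by (metis mult.assoc)
    qed simp
    also have "\<dots> = int (Suc k) * ffact (a + x) k"
      unfolding sum_distrib_left[symmetric] Suc.IH by simp
    also have "\<dots> = ffact (a + (x + 1)) (Suc k) - ffact (a + x) (Suc k)"
      using ffact_diff[of "a + x" k] by (simp add: add.assoc)
    finally show ?thesis .
  qed
  have "S x = ffact (a + x) (Suc k)"
  proof (induction x rule: int_induct[where k = 0])
    case base
    show ?case
      unfolding S_def sum.atMost_Suc_shift by (simp add: rothe_weight_Suc)
  next
    case (step1 i)
    with diff[of i] show ?case by simp
  next
    case (step2 i)
    with diff[of "i - 1"] show ?case by simp
  qed
  then show ?case by (simp only: S_def)
qed

theorem theorem1p3:
  fixes m n k :: nat
  assumes "0 < m" and "0 < n" and "m < n"
    and "1 < 2 * k" and "2 * k \<le> m" and "k \<le> n - m"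
  shows "int (kperm n k) - int (kperm (n - m) k) =
    int m * (\<Sum>r=1..k. int (k choose r) * int (kperm (m - r - 1) (r - 1)) * int (kperm (n - m + r) (k - r)))"
proof -
  let ?f = "\<lambda>r. int (k choose r) * rothe_weight (int m) r * ffact (int (n - m) + int r) (k - r)"
  have "int (kperm n k) = ffact (int (n - m) + int m) k"
    using assms by (simp add: kperm_eq_ffact)
  also have "\<dots> = (\<Sum>r\<le>k. ?f r)"
    by (rule rothe_convolution[symmetric])
  also have "\<dots> = ?f 0 + (\<Sum>r=1..k. ?f r)"
    by (simp add: atMost_atLeast0 sum.atLeast_Suc_atMost)
  also have "?f 0 = int (kperm (n - m) k)"
    using assms by (simp add: kperm_eq_ffact)
  also have "(\<Sum>r=1..k. ?f r) = (\<Sum>r=1..k. int m *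
      (int (k choose r) * int (kperm (m - r - 1) (r - 1)) * int (kperm (n - m + r) (k - r))))"
  proof (rule sum.cong)
    fix r assume "r \<in> {1..k}"
    then have r: "1 \<le> r" "r \<le> k" by auto
    have "int (kperm (m - r - 1) (r - 1)) = ffact (int m - int r - 1) (r - 1)"
      using r assms by (simp add: kperm_eq_ffact of_nat_diff algebra_simps)
    moreover have "int (kperm (n - m + r) (k - r)) = ffact (int (n - m) + int r) (k - r)"
      using r assms kperm_eq_ffact[of "k - r" "n - m + r"] by (simp only: of_nat_add)
    ultimately show "?f r = int m *
        (int (k choose r) * int (kperm (m - r - 1) (r - 1)) * int (kperm (n - m + r) (k - r)))"
      using r by (simp add: rothe_weight_def)
  qed simp
  finally show ?thesis
    by (simp add: sum_distrib_left)
qed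

end
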